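(* There is an absolute constant $K>0$ such that for every $n\ge 1$, every $f:\{0,1\}^n\to\{0,1\}$, every $\epsilon\in[0,\tfrac18]$ and every product distribution $\mu$ on $\{0,1\}^n$, $$D^{\mu}_{8\epsilon}(f)\le K\cdot \mathrm{prt}_\epsilon(f)^2\cdot\log(1/\epsilon),$$ where for $\epsilon=0$ the right-hand side is read as $+\infty$.
   Context: Let $f:\{0,1\}^n\to\{0,1\}$ and $[n]=\{1,\dots,n\}$; logarithms are base 2. Distributional query complexity: for a probability distribution $\mu$ on $\{0,1\}^n$ and $\delta\ge 0$, $D^\mu_\delta(f)$ is the minimum, over deterministic query algorithms (decision trees) $\mathcal A$ with $\Pr_{x\sim\mu}[\mathcal A(x)=f(x)]\ge 1-\delta$, of the worst-case (over inputs $x$) number of queried bits of $x$. A product distribution on $\{0,1\}^n$ is a distribution of the form $\mu(x)=\prod_{i\in[n]}\mu_i(x_i)$ with $\mu_i:\{0,1\}\to[0,1]$, $\mu_i(0)+\mu_i(1)=1$. Assignments: an assignment is a map $A:[n]\to\{0,1,*\}$, identified with the subcube $\{x: \forall i,\ x_i=A(i)\text{ or }A(i)=*\}$; $|A|=|\{i:A(i)\ne *\}|$ is its co-dimension. Partition bound: $\mathrm{prt}_\epsilon(f)$ is the (base 2) logarithm of the optimal value of the linear program in variables $w_{z,A}$ ($z\in\{0,1\}$, $A$ ranging over assignments): minimize $\sum_{z,A}w_{z,A}2^{|A|}$ subject to $\sum_{A\ni x}w_{f(x),A}\ge 1-\epsilon$ for all $x\in\{0,1\}^n$; $\sum_{z}\sum_{A\ni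 x}w_{z,A}=1$ for all $x\in\{0,1\}^n$; and $w_{z,A}\ge 0$ for all $z,A$. *)

theory Defs
  imports "HOL-Probability.Probability"
begin

definition cube :: "nat \<Rightarrow> (nat \<Rightarrow> bool) set" where
  "cube n = {1..n} \<rightarrow>\<^sub>E UNIV"

(* Query i T0 T1 reads the bit x i and continues with T0 on False (0), with T1 on True (1). *)
datatype dtree = Output bool | Query nat dtree dtree

primrec tree_output :: "dtree \<Rightarrow> (nat \<Rightarrow> bool) \<Rightarrow> bool" where
  "tree_output (Output b) x = b"
| "tree_output (Query i T0 T1) x = (if x i then tree_output T1 x else tree_output T0 x)"

primrec num_queries :: "dtree \<Rightarrow> (nat \<Rightarrow> bool) \<Rightarrow> nat" where
  "num_queries (Output b) x = 0"
| "num_queries (Query i T0 T1) x = Suc (if x i then num_queries T1 x else num_queries T0 x)"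

primrec query_indices :: "dtree \<Rightarrow> nat set" where
  "query_indices (Output b) = {}"
| "query_indices (Query i T0 T1) = insert i (query_indices T0 \<union> query_indices T1)"

definition worst_case_queries :: "nat \<Rightarrow> dtree \<Rightarrow> nat" where
  "worst_case_queries n T = Max (num_queries T ` cube n)"

(* For \<delta> \<ge> 0 the infimum is over a nonempty set of naturals, hence a minimum:
   the tree that reads all n bits computes f exactly. *)
definition dist_query_complexity ::
    "nat \<Rightarrow> (nat \<Rightarrow> bool) pmf \<Rightarrow> real \<Rightarrow> ((nat \<Rightarrow> bool) \<Rightarrow> bool) \<Rightarrow> nat" where
  "dist_query_complexity n \<mu> \<delta> f =
     Inf {worst_case_queries n T | T.
            query_indices T \<subseteq> {1..n} \<and>
            measure_pmf.prob \<mu> {x \<in> cube n. tree_output T x = f x} \<ge> 1 - \<delta>}"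

definition product_distribution :: "nat \<Rightarrow> (nat \<Rightarrow> bool) pmf \<Rightarrow> bool" where
  "product_distribution n \<mu> \<longleftrightarrow>
     set_pmf \<mu> \<subseteq> cube n \<and>
     (\<exists>m :: nat \<Rightarrow> bool pmf. \<forall>x \<in> cube n. pmf \<mu> x = (\<Prod>i\<in>{1..n}. pmf (m i) (x i)))"

(* The symbol * is encoded as None, so the co-dimension of A is card (dom A). *)
definition assignments :: "nat \<Rightarrow> (nat \<rightharpoonup> bool) set" where
  "assignments n = {A. dom A \<subseteq> {1..n}}"

definition subcube :: "nat \<Rightarrow> (nat \<rightharpoonup> bool) \<Rightarrow> (nat \<Rightarrow> bool) set" where
  "subcube n A = {x \<in> cube n. \<forall>i\<in>{1..n}. A i = Some (x i) \<or> A i = None}"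

definition prt_feasible ::
    "nat \<Rightarrow> real \<Rightarrow> ((nat \<Rightarrow> bool) \<Rightarrow> bool) \<Rightarrow> (bool \<Rightarrow> (nat \<rightharpoonup> bool) \<Rightarrow> real) \<Rightarrow> bool" where
  "prt_feasible n \<epsilon> f w \<longleftrightarrow>
     (\<forall>x \<in> cube n. (\<Sum>A | A \<in> assignments n \<and> x \<in> subcube n A. w (f x) A) \<ge> 1 - \<epsilon>) \<and>
     (\<forall>x \<in> cube n. (\<Sum>z\<in>UNIV. \<Sum>A | A \<in> assignments n \<and> x \<in> subcube n A. w z A) = 1) \<and>
     (\<forall>z. \<forall>A \<in> assignments n. w z A \<ge> 0)"

definition prt_objective :: "nat \<Rightarrow> (bool \<Rightarrow> (nat \<rightharpoonup> bool) \<Rightarrow> real) \<Rightarrow> real" where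
  "prt_objective n w = (\<Sum>z\<in>UNIV. \<Sum>A\<in>assignments n. w z A * 2 ^ card (dom A))"

(* For \<epsilon> \<ge> 0 the program is feasible (for each x in the cube, weight 1 on (f x, A) where A
   fixes all n coordinates to those of x), and every objective value is at least 1. *)
definition prt :: "nat \<Rightarrow> real \<Rightarrow> ((nat \<Rightarrow> bool) \<Rightarrow> bool) \<Rightarrow> real" where
  "prt n \<epsilon> f = log 2 (Inf {prt_objective n w | w. prt_feasible n \<epsilon> f w})"

end

theory Submission
  imports Defs
begin

text \<open>
  Fix a nearly optimal solution \<open>w\<close> of the linear program, with value at most \<open>2\<^bsup>c+1\<^esup>\<close>
  where \<open>c\<close> is the partition bound; \<open>c \<ge> 1/2\<close> unless \<open>f\<close> is constant. Subcubes of
  co-dimension larger than \<open>k = O(c)\<close> have total weight at most \<open>1/16\<close>, so they may be discarded.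
  Conditioning a product distribution on some bits gives a product distribution in which those bits
  have bias 0 or 1. Define its potential as the sum over \<open>z, A\<close> of \<open>w z A\<close> times the probability
  of \<open>A\<close> times the number of undetermined coordinates in \<open>dom A\<close>; this is at most \<open>k\<close>.

  If the minority value \<open>z\<close> of \<open>f\<close> has probability above \<open>6 \<epsilon>\<close>, some short subcube \<open>A\<close> is strongly
  biased towards \<open>z\<close>. The subcubes weighted for \<open>\<not> z\<close> cover little of \<open>A\<close>, but a constant fraction of
  the whole cube, so most of them share an undetermined coordinate with \<open>A\<close>. Hence
  querying \<open>dom A\<close> decreases the expected potential by at least \<open>1/5\<close>. After \<open>O(k log (1/\<epsilon>))\<close> such
  rounds of at most \<open>k\<close> queries, the minority value has probability at most \<open>6 \<epsilon>\<close> except on a set of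
  leaves of probability \<open>2 \<epsilon>\<close>.
\<close>

subsection \<open>Product distributions on the cube\<close>

definition bern :: "real \<Rightarrow> bool \<Rightarrow> real" where
  "bern q b = (if b then q else 1 - q)"

definition weight :: "nat \<Rightarrow> (nat \<Rightarrow> real) \<Rightarrow> (nat \<Rightarrow> bool) \<Rightarrow> real" where
  "weight n p x = (\<Prod>i\<in>{1..n}. bern (p i) (x i))"

definition expect :: "nat \<Rightarrow> (nat \<Rightarrow> real) \<Rightarrow> ((nat \<Rightarrow> bool) \<Rightarrow> real) \<Rightarrow> real" where
  "expect n p g = (\<Sum>x\<in>cube n. weight n p x * g x)"

definition biases :: "(nat \<Rightarrow> real) set" where
  "biases = {p. \<forall>i. 0 \<le> p i \<and> p i \<le> 1}"

definition subcube_prob :: "(nat \<Rightarrow> real) \<Rightarrow> (nat \<rightharpoonup> bool) \<Rightarrow> real" where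
  "subcube_prob p A = (\<Prod>i\<in>dom A. bern (p i) (the (A i)))"

text \<open>The biases of the input given that it lies in the subcube of \<open>A\<close>. The
  formula also makes sense when that subcube has probability 0, so the identities below carry no
  positivity assumption.\<close>

definition condition :: "(nat \<Rightarrow> real) \<Rightarrow> (nat \<rightharpoonup> bool) \<Rightarrow> nat \<Rightarrow> real" where
  "condition p A i = (case A i of None \<Rightarrow> p i | Some b \<Rightarrow> of_bool b)"

lemma finite_cube [simp]: "finite (cube n)"
  by (simp add: cube_def finite_PiE)

lemma finite_assignments [simp]: "finite (assignments n)"
proof -
  have "assignments n = (\<Union>S\<in>Pow {1..n}. {A. dom A = S \<and> ran A \<subseteq> (UNIV :: bool set)})"
    by (auto simp: assignments_def)
  also have "finite \<dots>"
    by (intro finite_UN_I finite_set_of_finite_maps) (auto intro: finite_subset)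
  finally show ?thesis .
qed

lemma finite_dom_assignment: "A \<in> assignments n \<Longrightarrow> finite (dom A)"
  by (auto simp: assignments_def intro: finite_subset)

lemma bern_nonneg: "p \<in> biases \<Longrightarrow> 0 \<le> bern (p i) b"
  by (simp add: biases_def bern_def)

lemma biases_upd [simp]: "p \<in> biases \<Longrightarrow> p(i := 0) \<in> biases" "p \<in> biases \<Longrightarrow> p(i := 1) \<in> biases"
  by (simp_all add: biases_def)

lemma biases_condition: "p \<in> biases \<Longrightarrow> condition p A \<in> biases"
  by (auto simp: biases_def condition_def split: option.split)

lemma weight_nonneg: "p \<in> biases \<Longrightarrow> 0 \<le> weight n p x"
  by (simp add: weight_def bern_nonneg prod_nonneg)

lemma subcube_prob_nonneg: "p \<in> biases \<Longrightarrow> 0 \<le> subcube_prob p A"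
  by (simp add: subcube_prob_def bern_nonneg prod_nonneg)

lemma expect_const: "expect n p (\<lambda>_. c) = c"
proof -
  have "(\<Sum>x\<in>cube n. weight n p x) = (\<Prod>i\<in>{1..n}. \<Sum>b\<in>UNIV. bern (p i) b)"
    unfolding weight_def cube_def by (subst prod_sum_PiE) auto
  also have "\<dots> = 1"
    by (simp add: bern_def UNIV_bool)
  finally show ?thesis
    by (simp add: expect_def flip: sum_distrib_right)
qed

lemma expect_mono:
  "p \<in> biases \<Longrightarrow> (\<And>x. x \<in> cube n \<Longrightarrow> g x \<le> h x) \<Longrightarrow> expect n p g \<le> expect n p h"
  unfolding expect_def by (intro sum_mono mult_left_mono weight_nonneg)

lemma expect_add: "expect n p (\<lambda>x. g x + h x) = expect n p g + expect n p h"
  by (simp add: expect_def algebra_simps sum.distrib)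

lemma expect_cmult: "expect n p (\<lambda>x. c * g x) = c * expect n p g"
  by (simp add: expect_def sum_distrib_left algebra_simps)

lemma expect_nonneg:
  "p \<in> biases \<Longrightarrow> (\<And>x. x \<in> cube n \<Longrightarrow> 0 \<le> g x) \<Longrightarrow> 0 \<le> expect n p g"
  unfolding expect_def by (intro sum_nonneg mult_nonneg_nonneg weight_nonneg)

lemma expect_sum: "expect n p (\<lambda>x. \<Sum>a\<in>S. g a x) = (\<Sum>a\<in>S. expect n p (g a))"
  unfolding expect_def sum_distrib_left by (rule sum.swap)

lemma expect_cong:
  "(\<And>x. x \<in> cube n \<Longrightarrow> g x = h x) \<Longrightarrow> expect n p g = expect n p h"
  by (simp add: expect_def)

lemma weight_remove:
  "i \<in> {1..n} \<Longrightarrow> weight n p x = bern (p i) (x i) * (\<Prod>j\<in>{1..n} - {i}. bern (p j) (x j))"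
  unfolding weight_def by (rule prod.remove) auto

text \<open>Law of total probability for one bit: the weight under \<open>p(i := 0)\<close> vanishes
  where \<open>x i\<close> is true and the weight under \<open>p(i := 1)\<close> where it is false,
  so only the summand matching the bit survives.\<close>

lemma weight_query:
  assumes "i \<in> {1..n}"
  shows "weight n p x * g (x i) =
    (1 - p i) * (weight n (p(i := 0)) x * g False) + p i * (weight n (p(i := 1)) x * g True)"
proof -
  have *: "(\<Prod>j\<in>{1..n} - {i}. bern ((p(i := c)) j) (x j)) = (\<Prod>j\<in>{1..n} - {i}. bern (p j) (x j))" for c
    by (rule prod.cong) auto
  show ?thesis
    unfolding weight_remove[OF assms] * by (simp add: bern_def)
qed

lemma expect_query:
  assumes "i \<in> {1..n}"
  shows "expect n p (\<lambda>x. if x i then h x else g x) =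
    (1 - p i) * expect n (p(i := 0)) g + p i * expect n (p(i := 1)) h"
proof -
  have "weight n p x * (if x i then h x else g x) =
    (1 - p i) * (weight n (p(i := 0)) x * g x) + p i * (weight n (p(i := 1)) x * h x)" for x
    using weight_query[OF assms, of p x "\<lambda>b. if b then h x else g x"] by simp
  then show ?thesis
    by (simp add: expect_def sum.distrib sum_distrib_left)
qed

text \<open>This is where the product structure enters: on the subcube the factors at
  \<open>dom A\<close> are constant with product \<open>subcube_prob p A\<close>, while the
  remaining factors are untouched by conditioning.\<close>

lemma expect_subcube:
  assumes A: "A \<in> assignments n"
  shows "expect n p (\<lambda>x. of_bool (x \<in> subcube n A) * g x) =
    subcube_prob p A * expect n (condition p A) g"
proof -
  have dom: "dom A \<subseteq> {1..n}"
    using A by (simp add: assignments_def)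
  have split: "weight n q x = (\<Prod>i\<in>dom A. bern (q i) (x i)) * (\<Prod>i\<in>{1..n} - dom A. bern (q i) (x i))"
    for q x
    unfolding weight_def by (subst prod.subset_diff[OF dom]) auto
  have "weight n p x * of_bool (x \<in> subcube n A) = subcube_prob p A * weight n (condition p A) x"
    if x: "x \<in> cube n" for x
  proof (cases "x \<in> subcube n A")
    case True
    have Ax: "A i = Some (x i)" if "i \<in> dom A" for i
      using that True dom by (force simp: subcube_def)
    have "(\<Prod>i\<in>dom A. bern (condition p A i) (x i)) = 1"
      by (intro prod.neutral) (auto simp: Ax condition_def bern_def)
    moreover have "(\<Prod>i\<in>dom A. bern (p i) (x i)) = subcube_prob p A"
      unfolding subcube_prob_def by (intro prod.cong) (auto simp: Ax)
    moreover have "(\<Prod>i\<in>{1..n} - dom A. bern (condition p A i) (x i)) =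
        (\<Prod>i\<in>{1..n} - dom A. bern (p i) (x i))"
      by (intro prod.cong) (auto simp: condition_def domIff)
    ultimately show ?thesis
      using True by (simp add: split)
  next
    case False
    \<comment> \<open>Outside the subcube, a violated coordinate makes one factor of the conditioned
      weight zero, so both sides vanish.\<close>
    then obtain i where i: "i \<in> {1..n}" "A i = Some (\<not> x i)"
      using x by (auto simp: subcube_def)
    then have "bern (condition p A i) (x i) = 0"
      by (simp add: condition_def bern_def)
    then have "weight n (condition p A) x = 0"
      unfolding weight_def using i(1) by (intro prod_zero) auto
    then show ?thesis
      using False by simp
  qed
  then have "weight n p x * (of_bool (x \<in> subcube n A) * g x) =
      subcube_prob p A * (weight n (condition p A) x * g x)" if "x \<in> cube n" for x
    using that by (metis mult.assoc)
  then show ?thesis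
    unfolding expect_def sum_distrib_left by (rule sum.cong[OF refl])
qed

lemma expect_indicator_subcube:
  "A \<in> assignments n \<Longrightarrow> expect n p (\<lambda>x. of_bool (x \<in> subcube n A)) = subcube_prob p A"
  using expect_subcube[of A n p "\<lambda>_. 1"] by (simp add: expect_const)

subsection \<open>Non-adaptive batches of queries\<close>

definition error :: "nat \<Rightarrow> ((nat \<Rightarrow> bool) \<Rightarrow> bool) \<Rightarrow> (nat \<Rightarrow> real) \<Rightarrow> dtree \<Rightarrow> real" where
  "error n f p T = expect n p (\<lambda>x. of_bool (tree_output T x \<noteq> f x))"

lemma error_Query:
  assumes "i \<in> {1..n}"
  shows "error n f p (Query i T0 T1) =
    (1 - p i) * error n f (p(i := 0)) T0 + p i * error n f (p(i := 1)) T1"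
  unfolding error_def by (subst expect_query[OF assms, symmetric]) (rule expect_cong, simp)

text \<open>The state of a partially executed query algorithm is recorded as the vector of biases of the
  input conditioned on the answers so far: an answered coordinate has bias 0 or 1.\<close>

primrec leaf_average :: "nat list \<Rightarrow> ((nat \<Rightarrow> real) \<Rightarrow> real) \<Rightarrow> (nat \<Rightarrow> real) \<Rightarrow> real" where
  "leaf_average [] V p = V p"
| "leaf_average (i # qs) V p =
    (1 - p i) * leaf_average qs V (p(i := 0)) + p i * leaf_average qs V (p(i := 1))"

primrec query_all :: "nat list \<Rightarrow> ((nat \<Rightarrow> real) \<Rightarrow> dtree) \<Rightarrow> (nat \<Rightarrow> real) \<Rightarrow> dtree" where
  "query_all [] F p = F p"
| "query_all (i # qs) F p = Query i (query_all qs F (p(i := 0))) (query_all qs F (p(i := 1)))"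

lemma error_query_all:
  "set qs \<subseteq> {1..n} \<Longrightarrow>
    error n f p (query_all qs F p) = leaf_average qs (\<lambda>q. error n f q (F q)) p"
  by (induction qs arbitrary: p) (auto simp: error_Query)

lemma num_queries_query_all:
  assumes "\<And>q x. q \<in> biases \<Longrightarrow> num_queries (F q) x \<le> d" "p \<in> biases"
  shows "num_queries (query_all qs F p) x \<le> length qs + d"
  using assms(2) by (induction qs arbitrary: p) (auto simp: assms(1))

lemma query_indices_query_all:
  assumes "\<And>q. q \<in> biases \<Longrightarrow> query_indices (F q) \<subseteq> I" "set qs \<subseteq> I" "p \<in> biases"
  shows "query_indices (query_all qs F p) \<subseteq> I"
  using assms(2,3)
proof (induction qs arbitrary: p)
  case (Cons i qs)
  have "set qs \<subseteq> I" and p: "p \<in> biases"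
    using Cons.prems by auto
  from Cons.IH[OF this(1) biases_upd(1)[OF p]] Cons.IH[OF this(1) biases_upd(2)[OF p]] Cons.prems(1)
  show ?case
    by (simp del: fun_upd_apply)
qed (simp add: assms(1))

lemma leaf_average_mono:
  assumes "\<And>q. q \<in> biases \<Longrightarrow> V q \<le> W q" "p \<in> biases"
  shows "leaf_average qs V p \<le> leaf_average qs W p"
  using assms(2)
proof (induction qs arbitrary: p)
  case (Cons i qs)
  have "0 \<le> 1 - p i" "0 \<le> p i"
    using Cons.prems by (simp_all add: biases_def)
  then show ?case
    using Cons.IH[OF biases_upd(1)[OF Cons.prems]] Cons.IH[OF biases_upd(2)[OF Cons.prems]]
    unfolding leaf_average.simps by (intro add_mono mult_left_mono)
qed (simp add: assms(1))

lemma leaf_average_affine: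
  "leaf_average qs (\<lambda>q. a + b * V q) p = a + b * leaf_average qs V p"
  by (induction qs arbitrary: p) (auto simp: algebra_simps)

lemma leaf_average_cmult:
  "leaf_average qs (\<lambda>q. b * V q) p = b * leaf_average qs V p"
  using leaf_average_affine[of qs 0 b V p] by simp

lemma leaf_average_sum:
  "leaf_average qs (\<lambda>q. \<Sum>a\<in>S. V a q) p = (\<Sum>a\<in>S. leaf_average qs (V a) p)"
  by (induction qs arbitrary: p) (simp_all add: sum.distrib sum_distrib_left)

lemma subcube_prob_remove:
  assumes "finite (dom A)" "A i = Some b"
  shows "subcube_prob p A = bern (p i) b * (\<Prod>j\<in>dom A - {i}. bern (p j) (the (A j)))"
  unfolding subcube_prob_def
  by (subst prod.remove[of "dom A" i]) (use assms in auto)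

text \<open>The probability of a subcube is a martingale under querying, and the undetermined
  coordinates lost are exactly the queried ones, whatever the answers.\<close>

lemma leaf_average_subcube:
  assumes "finite (dom A)"
  shows "leaf_average qs (\<lambda>q. subcube_prob q A * card {j \<in> dom A. 0 < q j \<and> q j < 1}) p =
    subcube_prob p A * card {j \<in> dom A - set qs. 0 < p j \<and> p j < 1}"
proof (induction qs arbitrary: p)
  case (Cons i qs)
  show ?case
  proof (cases "A i")
    case None
    then have "subcube_prob (p(i := c)) A = subcube_prob p A" for c
      unfolding subcube_prob_def by (intro prod.cong) auto
    moreover have "{j \<in> dom A - set qs. 0 < (p(i := c)) j \<and> (p(i := c)) j < 1} =
        {j \<in> dom A - set (i # qs). 0 < p j \<and> p j < 1}" for c
      using None by auto
    ultimately show ?thesis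
      unfolding leaf_average.simps Cons.IH by (simp add: algebra_simps)
  next
    case (Some b)
    let ?P = "\<Prod>j\<in>dom A - {i}. bern (p j) (the (A j))"
    have P: "(\<Prod>j\<in>dom A - {i}. bern ((p(i := c)) j) (the (A j))) = ?P" for c
      by (intro prod.cong) auto
    let ?C = "card {j \<in> dom A - set (i # qs). 0 < p j \<and> p j < 1}"
    \<comment> \<open>An answered coordinate has bias 0 or 1 and leaves the count, exactly as if it
      were removed from \<open>dom A\<close> as a list entry.\<close>
    have C: "card {j \<in> dom A - set qs. 0 < (p(i := of_bool c)) j \<and> (p(i := of_bool c)) j < 1} = ?C" for c
      by (rule arg_cong[where f = card]) auto
    have "leaf_average (i # qs) (\<lambda>q. subcube_prob q A * card {j \<in> dom A. 0 < q j \<and> q j < 1}) p =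
        (1 - p i) * (subcube_prob (p(i := 0)) A * ?C) + p i * (subcube_prob (p(i := 1)) A * ?C)"
      unfolding leaf_average.simps Cons.IH using C[of False] C[of True] by (simp del: fun_upd_apply)
    \<comment> \<open>The branch whose answer contradicts \<open>A\<close> contributes 0.\<close>
    also have "\<dots> = bern (p i) b * ?P * ?C"
      unfolding subcube_prob_remove[OF assms Some] P by (cases b) (simp_all add: bern_def)
    finally show ?thesis
      unfolding subcube_prob_remove[OF assms Some] .
  qed
qed simp

subsection \<open>The potential argument\<close>

text \<open>What remains of a feasible solution after truncation to co-dimension at most
  \<open>k\<close>. Coverage by correct subcubes may lose 1/16, the equality constraint weakens to
  an upper bound, and \<open>wrong\<close> combines both constraints of the program.\<close>

locale short_cover =
  fixes n k :: nat and \<epsilon> :: real and f :: "(nat \<Rightarrow> bool) \<Rightarrow> bool"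
    and w :: "bool \<Rightarrow> (nat \<rightharpoonup> bool) \<Rightarrow> real" and S :: "(nat \<rightharpoonup> bool) set"
  assumes S: "S \<subseteq> assignments n" and k_pos: "0 < k"
    and short: "A \<in> S \<Longrightarrow> card (dom A) \<le> k"
    and w_nonneg: "A \<in> S \<Longrightarrow> 0 \<le> w z A"
    and covered: "x \<in> cube n \<Longrightarrow> 1 - \<epsilon> - 1/16 \<le> (\<Sum>A\<in>S. w (f x) A * of_bool (x \<in> subcube n A))"
    and packed: "x \<in> cube n \<Longrightarrow> (\<Sum>z\<in>UNIV. \<Sum>A\<in>S. w z A * of_bool (x \<in> subcube n A)) \<le> 1"
    and wrong: "x \<in> cube n \<Longrightarrow> (\<Sum>A\<in>S. w (\<not> f x) A * of_bool (x \<in> subcube n A)) \<le> \<epsilon>"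
    and eps: "0 < \<epsilon>"
begin

definition potential :: "(nat \<Rightarrow> real) \<Rightarrow> real" where
  "potential p = (\<Sum>z\<in>UNIV. \<Sum>A\<in>S. w z A * (subcube_prob p A * card {j \<in> dom A. 0 < p j \<and> p j < 1}))"

definition prob_val :: "(nat \<Rightarrow> real) \<Rightarrow> bool \<Rightarrow> real" where
  "prob_val p z = expect n p (\<lambda>x. of_bool (f x = z))"

lemma finite_dom: "A \<in> S \<Longrightarrow> finite (dom A)"
  using S finite_dom_assignment by blast

lemma prob_val_not: "prob_val p (\<not> z) = 1 - prob_val p z"
proof -
  have "prob_val p (\<not> z) + prob_val p z = expect n p (\<lambda>_. 1)"
    unfolding prob_val_def expect_add[symmetric] by (rule expect_cong) auto
  then show ?thesis
    by (simp add: expect_const)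
qed

lemma prob_val_nonneg: "p \<in> biases \<Longrightarrow> 0 \<le> prob_val p z"
  unfolding prob_val_def by (rule expect_nonneg) auto

lemma expect_cover:
  "expect n p (\<lambda>x. (\<Sum>A\<in>S. w z A * of_bool (x \<in> subcube n A)) * g x) =
    (\<Sum>A\<in>S. w z A * expect n p (\<lambda>x. of_bool (x \<in> subcube n A) * g x))"
  by (simp add: sum_distrib_right expect_sum mult.assoc expect_cmult)

lemma expect_cover_subcube_prob:
  "expect n p (\<lambda>x. \<Sum>A\<in>S. w z A * of_bool (x \<in> subcube n A)) = (\<Sum>A\<in>S. w z A * subcube_prob p A)"
  using expect_cover[of p z "\<lambda>_. 1"] S
  by (simp add: expect_indicator_subcube subset_iff)

lemma potential_nonneg: "p \<in> biases \<Longrightarrow> 0 \<le> potential p"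
  unfolding potential_def
  by (intro sum_nonneg mult_nonneg_nonneg w_nonneg subcube_prob_nonneg) auto

text \<open>The potential is the expected number of undetermined coordinates in the weighted
  subcubes around a random point. The total weight at a point is at most 1, and each subcube fixes
  at most \<open>k\<close> coordinates.\<close>

lemma potential_le:
  assumes p: "p \<in> biases"
  shows "potential p \<le> k"
proof -
  have "potential p \<le> (\<Sum>z\<in>UNIV. \<Sum>A\<in>S. w z A * (subcube_prob p A * k))"
    unfolding potential_def
  proof (intro sum_mono mult_left_mono w_nonneg subcube_prob_nonneg p)
    fix A assume A: "A \<in> S"
    have "card {j \<in> dom A. 0 < p j \<and> p j < 1} \<le> card (dom A)"
      by (intro card_mono finite_dom A) auto
    with short[OF A] show "real (card {j \<in> dom A. 0 < p j \<and> p j < 1}) \<le> real k"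
      by simp
  qed auto
  also have "\<dots> = (\<Sum>z\<in>UNIV. expect n p (\<lambda>x. \<Sum>A\<in>S. w z A * of_bool (x \<in> subcube n A))) * k"
    unfolding expect_cover_subcube_prob by (simp add: sum_distrib_right mult.assoc)
  also have "\<dots> = expect n p (\<lambda>x. \<Sum>z\<in>UNIV. \<Sum>A\<in>S. w z A * of_bool (x \<in> subcube n A)) * k"
    by (simp add: expect_sum)
  also have "\<dots> \<le> expect n p (\<lambda>_. 1) * k"
    by (intro mult_right_mono expect_mono[OF p] packed) auto
  finally show ?thesis
    by (simp add: expect_const)
qed

text \<open>An averaging argument. Over the inputs with value \<open>z\<close>, the subcubes
  weighted for \<open>z\<close> have total mass above \<open>5 * \<epsilon>\<close>; over the other
  inputs the same subcubes have mass at most \<open>\<epsilon> * prob_val p (\<not> z)\<close>. Some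
  subcube does at least as well as the ratio of these bounds, which is
  \<open>\<rho>\<close>.\<close>

lemma exists_biased_subcube:
  assumes p: "p \<in> biases" and big: "6 * \<epsilon> < prob_val p z" and small: "prob_val p z \<le> 1/2"
  obtains A where "A \<in> S" "0 < subcube_prob p A"
    "prob_val (condition p A) (\<not> z) \<le> prob_val p (\<not> z) / 5"
proof -
  define a where "a A = expect n p (\<lambda>x. of_bool (x \<in> subcube n A) * of_bool (f x = z))" for A
  define b where "b A = expect n p (\<lambda>x. of_bool (x \<in> subcube n A) * of_bool (f x = (\<not> z)))" for A
  define \<rho> where "\<rho> = prob_val p (\<not> z) / 5"
  have a0: "0 \<le> a A" and b0: "0 \<le> b A" for A
    unfolding a_def b_def by (auto intro!: expect_nonneg p)
  have \<rho>: "0 < \<rho>"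
    using small by (simp add: \<rho>_def prob_val_not)
  have "(\<Sum>A\<in>S. w z A * b A) = expect n p (\<lambda>x. (\<Sum>A\<in>S. w z A * of_bool (x \<in> subcube n A)) * of_bool (f x = (\<not> z)))"
    unfolding b_def by (rule expect_cover[symmetric])
  also have "\<dots> \<le> expect n p (\<lambda>x. \<epsilon> * of_bool (f x = (\<not> z)))"
    by (rule expect_mono[OF p]) (use wrong in force)
  finally have upper: "(\<Sum>A\<in>S. w z A * b A) \<le> \<epsilon> * prob_val p (\<not> z)"
    by (simp add: prob_val_def expect_cmult)
  have "(1 - \<epsilon> - 1/16) * prob_val p z = expect n p (\<lambda>x. (1 - \<epsilon> - 1/16) * of_bool (f x = z))"
    by (simp add: prob_val_def expect_cmult)
  also have "\<dots> \<le> expect n p (\<lambda>x. (\<Sum>A\<in>S. w z A * of_bool (x \<in> subcube n A)) * of_bool (f x = z))"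
    by (rule expect_mono[OF p]) (use covered in force)
  also have "\<dots> = (\<Sum>A\<in>S. w z A * a A)"
    unfolding a_def by (rule expect_cover)
  finally have "(1 - \<epsilon> - 1/16) * prob_val p z \<le> (\<Sum>A\<in>S. w z A * a A)" .
  \<comment> \<open>From \<open>6 * \<epsilon> < 1/2\<close> follows
    \<open>\<epsilon> < 1/12\<close>, and 1 - 1/12 - 1/16 = 41/48 exceeds 5/6.\<close>
  moreover have "5/6 * prob_val p z \<le> (1 - \<epsilon> - 1/16) * prob_val p z"
    using big small eps by (intro mult_right_mono) auto
  ultimately have lower: "5 * \<epsilon> < (\<Sum>A\<in>S. w z A * a A)"
    using big by linarith
  have "\<exists>A\<in>S. 0 < a A \<and> b A \<le> \<rho> * a A"
  proof (rule ccontr)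
    assume "\<not> ?thesis"
    then have "\<rho> * a A \<le> b A" if "A \<in> S" for A
      using that a0[of A] b0[of A] by (cases "a A = 0") force+
    then have "(\<Sum>A\<in>S. w z A * (\<rho> * a A)) \<le> (\<Sum>A\<in>S. w z A * b A)"
      by (intro sum_mono mult_left_mono w_nonneg)
    then have "\<rho> * (\<Sum>A\<in>S. w z A * a A) \<le> \<epsilon> * prob_val p (\<not> z)"
      using upper by (simp add: sum_distrib_left mult.left_commute)
    moreover have "\<rho> * (5 * \<epsilon>) < \<rho> * (\<Sum>A\<in>S. w z A * a A)"
      using lower \<rho> by simp
    moreover have "\<rho> * (5 * \<epsilon>) = \<epsilon> * prob_val p (\<not> z)"
      by (simp add: \<rho>_def)
    ultimately show False
      by linarith
  qed
  then obtain A where A: "A \<in> S" and aA: "0 < a A" and bA: "b A \<le> \<rho> * a A"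
    by blast
  have An: "A \<in> assignments n"
    using A S by blast
  have a_eq: "a A = subcube_prob p A * prob_val (condition p A) z"
    and b_eq: "b A = subcube_prob p A * prob_val (condition p A) (\<not> z)"
    unfolding a_def b_def prob_val_def by (rule expect_subcube[OF An])+
  have pos: "0 < subcube_prob p A"
    using aA a_eq subcube_prob_nonneg[OF p, of A] by (cases "subcube_prob p A = 0") auto
  have "prob_val (condition p A) (\<not> z) \<le> \<rho> * prob_val (condition p A) z"
    using bA pos unfolding a_eq b_eq by (simp add: mult.left_commute[of \<rho>])
  also have "\<dots> \<le> \<rho> * 1"
    using \<rho> prob_val_nonneg[OF biases_condition[OF p], of A "\<not> z"] prob_val_not[of "condition p A" z]
    by (intro mult_left_mono) auto
  finally show thesis
    using that[OF A pos] by (simp add: \<rho>_def)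
qed

text \<open>If \<open>A\<close> and \<open>B\<close> share an undetermined coordinate, the count
  drops by at least 1, which saves the whole probability of \<open>B\<close>. Otherwise conditioning
  on \<open>A\<close> does not change the probability of \<open>B\<close>, and the subtracted
  difference is 0.\<close>

lemma subcube_prob_drop:
  assumes p: "p \<in> biases" and B: "finite (dom B)" and A: "finite (dom A)" "0 < subcube_prob p A"
  shows "subcube_prob p B * card {j \<in> dom B - dom A. 0 < p j \<and> p j < 1} \<le>
    subcube_prob p B * card {j \<in> dom B. 0 < p j \<and> p j < 1} -
      (subcube_prob p B - subcube_prob (condition p A) B)"
proof (cases "\<exists>j \<in> dom B \<inter> dom A. 0 < p j \<and> p j < 1")
  case True
  then have "{j \<in> dom B - dom A. 0 < p j \<and> p j < 1} \<subset> {j \<in> dom B. 0 < p j \<and> p j < 1}"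
    by auto
  then have "card {j \<in> dom B - dom A. 0 < p j \<and> p j < 1} < card {j \<in> dom B. 0 < p j \<and> p j < 1}"
    by (intro psubset_card_mono) (use B in auto)
  then have "subcube_prob p B * (card {j \<in> dom B - dom A. 0 < p j \<and> p j < 1} + 1) \<le>
      subcube_prob p B * card {j \<in> dom B. 0 < p j \<and> p j < 1}"
    by (intro mult_left_mono subcube_prob_nonneg p) linarith
  then show ?thesis
    using subcube_prob_nonneg[OF biases_condition[OF p], of A B] by (simp add: algebra_simps)
next
  case False
  have "condition p A j = p j" if "j \<in> dom B" for j
  proof (cases "A j")
    case (Some b)
    \<comment> \<open>Since \<open>A\<close> has positive probability, an already determined bit
      agrees with \<open>A\<close>.\<close>
    have "bern (p j) b \<noteq> 0"
      using A(2) unfolding subcube_prob_remove[of A, OF A(1) Some] by auto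
    moreover have "\<not> (0 < p j \<and> p j < 1)" "0 \<le> p j" "p j \<le> 1"
      using False that Some p by (auto simp: biases_def)
    then have "p j = 0 \<or> p j = 1"
      by linarith
    ultimately show ?thesis
      using Some by (auto simp: condition_def bern_def split: if_splits)
  qed (simp add: condition_def)
  then have "subcube_prob (condition p A) B = subcube_prob p B"
    by (simp add: subcube_prob_def)
  moreover have "card {j \<in> dom B - dom A. 0 < p j \<and> p j < 1} \<le> card {j \<in> dom B. 0 < p j \<and> p j < 1}"
    by (intro card_mono) (use B in auto)
  ultimately show ?thesis
    using subcube_prob_nonneg[OF p, of B] by (simp add: mult_left_mono)
qed

lemma potential_drop:
  assumes p: "p \<in> biases" and big: "6 * \<epsilon> < prob_val p z" and small: "prob_val p z \<le> 1/2"
  obtains qs where "set qs \<subseteq> {1..n}" "length qs \<le> k"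
    "leaf_average qs potential p \<le> potential p - 1/5"
proof -
  obtain A where A: "A \<in> S" and pos: "0 < subcube_prob p A"
    and biased: "prob_val (condition p A) (\<not> z) \<le> prob_val p (\<not> z) / 5"
    using exists_biased_subcube[OF assms] .
  obtain qs where set_qs: "set qs = dom A" and dist: "distinct qs"
    using finite_distinct_list[OF finite_dom[OF A]] by blast
  define q where "q = condition p A"
  have q: "q \<in> biases"
    unfolding q_def by (rule biases_condition[OF p])
  define c where "c r B = subcube_prob r B * card {j \<in> dom B. 0 < r j \<and> r j < 1}" for r B
  define d where "d B = subcube_prob p B * card {j \<in> dom B - dom A. 0 < p j \<and> p j < 1}" for B
  have d_le: "d B \<le> c p B - (subcube_prob p B - subcube_prob q B)" if "B \<in> S" for B
    unfolding c_def d_def q_def by (rule subcube_prob_drop[OF p finite_dom[OF that] finite_dom[OF A] pos])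
  have d_le': "d B \<le> c p B" if "B \<in> S" for B
    unfolding c_def d_def
    by (intro mult_left_mono subcube_prob_nonneg p of_nat_mono card_mono) (use finite_dom[OF that] in auto)
  have pot: "potential r = (\<Sum>z\<in>UNIV. \<Sum>B\<in>S. w z B * c r B)" for r
    by (simp add: potential_def c_def)
  have "leaf_average qs potential p = (\<Sum>z\<in>UNIV. \<Sum>B\<in>S. w z B * d B)"
    unfolding potential_def leaf_average_sum leaf_average_cmult
    by (intro sum.cong refl) (simp add: leaf_average_subcube finite_dom set_qs d_def)
  also have "\<dots> = (\<Sum>B\<in>S. w z B * d B) + (\<Sum>B\<in>S. w (\<not> z) B * d B)"
    by (cases z) (simp_all add: UNIV_bool)
  \<comment> \<open>The gain is taken only from the subcubes weighted for \<open>\<not> z\<close>;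
    for those weighted for \<open>z\<close> it suffices that the count does not grow.\<close>
  also have "\<dots> \<le> (\<Sum>B\<in>S. w z B * c p B) +
      (\<Sum>B\<in>S. w (\<not> z) B * (c p B - (subcube_prob p B - subcube_prob q B)))"
    by (intro add_mono sum_mono mult_left_mono w_nonneg d_le d_le')
  also have "\<dots> = potential p - (\<Sum>B\<in>S. w (\<not> z) B * subcube_prob p B) +
      (\<Sum>B\<in>S. w (\<not> z) B * subcube_prob q B)"
    unfolding pot by (cases z) (simp_all add: UNIV_bool algebra_simps sum.distrib sum_subtractf)
  finally have drop: "leaf_average qs potential p \<le> \<dots>" .
  have "(1 - \<epsilon> - 1/16) * prob_val p (\<not> z) = expect n p (\<lambda>x. (1 - \<epsilon> - 1/16) * of_bool (f x = (\<not> z)))"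
    by (simp add: prob_val_def expect_cmult)
  also have "\<dots> \<le> expect n p (\<lambda>x. \<Sum>A\<in>S. w (\<not> z) A * of_bool (x \<in> subcube n A))"
  proof (rule expect_mono[OF p])
    fix x assume "x \<in> cube n"
    with covered[of x] show "(1 - \<epsilon> - 1/16) * of_bool (f x = (\<not> z)) \<le>
        (\<Sum>A\<in>S. w (\<not> z) A * of_bool (x \<in> subcube n A))"
      by (cases "f x = (\<not> z)") (auto intro!: sum_nonneg w_nonneg)
  qed
  finally have lower: "(1 - \<epsilon> - 1/16) * prob_val p (\<not> z) \<le> (\<Sum>B\<in>S. w (\<not> z) B * subcube_prob p B)"
    unfolding expect_cover_subcube_prob .
  have "expect n q (\<lambda>x. \<Sum>A\<in>S. w (\<not> z) A * of_bool (x \<in> subcube n A)) \<le>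
      expect n q (\<lambda>x. of_bool (f x = (\<not> z)) + \<epsilon>)"
  proof (rule expect_mono[OF q])
    fix x assume x: "x \<in> cube n"
    \<comment> \<open>Where \<open>f x\<close> equals \<open>\<not> z\<close>, packing bounds the
      cover by 1; elsewhere these subcubes are wrong and weigh at most
      \<open>\<epsilon>\<close>.\<close>
    have "(\<Sum>A\<in>S. w y A * of_bool (x \<in> subcube n A)) \<ge> 0" for y
      by (auto intro!: sum_nonneg w_nonneg)
    from this[of z] packed[OF x] wrong[OF x] eps
    show "(\<Sum>A\<in>S. w (\<not> z) A * of_bool (x \<in> subcube n A)) \<le> of_bool (f x = (\<not> z)) + \<epsilon>"
      by (cases z; cases "f x") (auto simp: UNIV_bool)
  qed
  then have upper: "(\<Sum>B\<in>S. w (\<not> z) B * subcube_prob q B) \<le> prob_val q (\<not> z) + \<epsilon>"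
    unfolding expect_cover_subcube_prob expect_add expect_const prob_val_def .
  have "5/6 * prob_val p (\<not> z) \<le> (1 - \<epsilon> - 1/16) * prob_val p (\<not> z)"
    using big small by (intro mult_right_mono prob_val_nonneg p) auto
  \<comment> \<open>With P the probability of \<open>\<not> z\<close> under \<open>p\<close>, the
    drop is at least 5/6 P - P/5 - \<open>\<epsilon>\<close>. As P is at least 1/2 and
    \<open>\<epsilon> < 1/12\<close>, this is at least 7/30, more than 1/5.\<close>
  then have "leaf_average qs potential p \<le> potential p - 1/5"
    using drop lower upper biased big small prob_val_not[of p z] unfolding q_def by linarith
  moreover have "set qs \<subseteq> {1..n}"
    using A S by (auto simp: set_qs assignments_def)
  moreover have "length qs \<le> k"
    using short[OF A] distinct_card[OF dist] by (simp add: set_qs)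
  ultimately show thesis
    using that by blast
qed

lemma error_Output: "error n f p (Output z) = prob_val p (\<not> z)"
  unfolding error_def prob_val_def by (rule expect_cong) auto

text \<open>Adding \<open>k\<close> to the potential makes the additive drop \<open>1/5\<close> a multiplicative one, since the
  sum stays between \<open>k\<close> and \<open>2 k\<close>. A decay of the potential alone would cost an extra factor
  \<open>log k\<close>.\<close>

lemma exists_tree:
  "\<exists>F. \<forall>p\<in>biases. query_indices (F p) \<subseteq> {1..n} \<and> (\<forall>x. num_queries (F p) x \<le> k * t) \<and>
    error n f p (F p) \<le> 6 * \<epsilon> + (1 - 1 / (10 * real k)) ^ t * ((potential p + k) / k)"
proof (induction t)
  case 0
  show ?case
  proof (intro exI[of _ "\<lambda>_. Output True"] ballI conjI allI)
    fix p :: "nat \<Rightarrow> real" assume p: "p \<in> biases"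
    \<comment> \<open>With no rounds left the bound is trivial: the added \<open>k\<close> already
      makes the last term at least 1.\<close>
    have "error n f p (Output True) \<le> 1"
      using prob_val_nonneg[OF p, of True] by (simp add: error_Output prob_val_not[of p True, simplified])
    also have "1 \<le> 6 * \<epsilon> + (potential p + k) / k"
      using potential_nonneg[OF p] eps k_pos by (simp add: add_divide_distrib)
    finally show "error n f p (Output True) \<le>
        6 * \<epsilon> + (1 - 1 / (10 * real k)) ^ 0 * ((potential p + k) / k)"
      by simp
  qed auto
next
  case (Suc t)
  define r :: real where "r = 1 - 1 / (10 * real k)"
  have r: "0 \<le> r"
    using k_pos by (simp add: r_def field_simps)
  obtain F where F: "\<And>p. p \<in> biases \<Longrightarrow> query_indices (F p) \<subseteq> {1..n}"
    "\<And>p x. p \<in> biases \<Longrightarrow> num_queries (F p) x \<le> k * t"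
    "\<And>p. p \<in> biases \<Longrightarrow> error n f p (F p) \<le> 6 * \<epsilon> + r ^ t * ((potential p + k) / k)"
    using Suc unfolding r_def by blast
  have "\<exists>T. query_indices T \<subseteq> {1..n} \<and> (\<forall>x. num_queries T x \<le> k * Suc t) \<and>
    error n f p T \<le> 6 * \<epsilon> + r ^ Suc t * ((potential p + k) / k)" if p: "p \<in> biases" for p
  proof (cases "\<exists>z. prob_val p z \<le> 6 * \<epsilon>")
    case True
    \<comment> \<open>An unlikely value \<open>z\<close> allows stopping at once with the opposite
      answer.\<close>
    then obtain z where "prob_val p z \<le> 6 * \<epsilon>" ..
    moreover have "0 \<le> r ^ Suc t * ((potential p + k) / k)"
      using potential_nonneg[OF p] r by simp
    ultimately show ?thesis
      by (intro exI[of _ "Output (\<not> z)"]) (simp add: error_Output)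
  next
    case False
    obtain z where z: "prob_val p z \<le> 1/2"
      using prob_val_not[of p True] by (cases "prob_val p True \<le> 1/2") (auto intro: that[of True] that[of False])
    have "6 * \<epsilon> < prob_val p z"
      using False by (meson not_le)
    then obtain qs where qs: "set qs \<subseteq> {1..n}" "length qs \<le> k"
      and drop: "leaf_average qs potential p \<le> potential p - 1/5"
      using potential_drop[OF p _ z] by blast
    let ?T = "query_all qs F p"
    have "error n f p ?T = leaf_average qs (\<lambda>q. error n f q (F q)) p"
      by (rule error_query_all[OF qs(1)])
    \<comment> \<open>The induction hypothesis at the leaves is affine in the potential, so
      averaging the error reduces to averaging the potential.\<close>
    also have "\<dots> \<le> leaf_average qs (\<lambda>q. (6 * \<epsilon> + r ^ t) + r ^ t / k * potential q) p"
      by (rule leaf_average_mono[OF order_trans[OF F(3)] p]) (use k_pos in \<open>auto simp: field_simps\<close>)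
    also have "\<dots> = (6 * \<epsilon> + r ^ t) + r ^ t / k * leaf_average qs potential p"
      by (rule leaf_average_affine)
    also have "\<dots> \<le> (6 * \<epsilon> + r ^ t) + r ^ t / k * (potential p - 1/5)"
      using drop r by (intro add_left_mono mult_left_mono) auto
    also have "\<dots> = 6 * \<epsilon> + r ^ t * ((potential p + k - 1/5) / k)"
      using k_pos by (simp add: field_simps)
    also have "\<dots> \<le> 6 * \<epsilon> + r ^ t * (r * ((potential p + k) / k))"
    proof (intro add_left_mono mult_left_mono)
      \<comment> \<open>As \<open>potential p + k\<close> is at most \<open>2 * k\<close>, the drop
        1/5 is at least the fraction \<open>1 / (10 * k)\<close> of it.\<close>
      have "1 / (10 * real k) * (potential p + k) \<le> 1 / (10 * real k) * (2 * k)"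
        using potential_le[OF p] by (intro mult_left_mono) auto
      also have "\<dots> = 1/5"
        using k_pos by simp
      finally have "potential p + k - 1/5 \<le> r * (potential p + k)"
        unfolding r_def left_diff_distrib mult_1 by linarith
      then have "(potential p + k - 1/5) / k \<le> r * (potential p + k) / k"
        by (intro divide_right_mono) auto
      then show "(potential p + k - 1/5) / k \<le> r * ((potential p + k) / k)"
        by simp
    qed (use r in simp)
    finally have err: "error n f p ?T \<le> 6 * \<epsilon> + r ^ Suc t * ((potential p + k) / k)"
      by (simp only: power_Suc2 mult.assoc)
    have "num_queries ?T x \<le> k * Suc t" for x
      using num_queries_query_all[where F = F, OF F(2) p, of qs x] qs(2) by simp
    then show ?thesis
      using err query_indices_query_all[where F = F, OF F(1) qs(1) p] by blast
  qed
  then show ?case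
    unfolding r_def by metis
qed

end

subsection \<open>The linear program\<close>

text \<open>Total assignments, each labelled by the value of \<open>f\<close> at its only point,
  form an exact solution. Hence the infimum defining \<open>prt\<close> is over a nonempty set and
  can be approximated.\<close>

lemma exists_prt_feasible:
  assumes "0 \<le> \<epsilon>"
  shows "\<exists>w. prt_feasible n \<epsilon> f w"
proof
  define w :: "bool \<Rightarrow> (nat \<rightharpoonup> bool) \<Rightarrow> real" where
    "w z A = of_bool (dom A = {1..n} \<and> f (restrict (\<lambda>i. the (A i)) {1..n}) = z)" for z A
  have w: "(\<Sum>A | A \<in> assignments n \<and> x \<in> subcube n A. w z A) = of_bool (f x = z)"
    if x: "x \<in> cube n" for x z
  proof -
    define X where "X i = (if i \<in> {1..n} then Some (x i) else None)" for i
    have dom_X: "dom X = {1..n}"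
      by (auto simp: X_def split: if_splits)
    have "X i = Some (x i)" if "i \<in> {1..n}" for i
      using that by (simp add: X_def)
    then have X: "X \<in> {A. A \<in> assignments n \<and> x \<in> subcube n A}"
      using x by (simp add: assignments_def dom_X subcube_def)
    have "restrict (\<lambda>i. the (X i)) {1..n} = x"
      using x by (auto simp: X_def cube_def PiE_def extensional_def restrict_def)
    then have wX: "w z X = of_bool (f x = z)"
      by (simp add: w_def dom_X)
    \<comment> \<open>Only total assignments carry weight, and \<open>X\<close> is the only total
      assignment whose subcube contains \<open>x\<close>.\<close>
    have "w z A = 0" if A: "A \<in> assignments n" "x \<in> subcube n A" "A \<noteq> X" for A
    proof -
      have "dom A \<noteq> {1..n}"
      proof
        assume d: "dom A = {1..n}"
        have "A i = X i" for i
        proof (cases "i \<in> {1..n}")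
          case True
          with d obtain b where "A i = Some b"
            by blast
          with True A(2) show ?thesis
            by (force simp: subcube_def X_def)
        next
          case False
          with d have "A i = None"
            by blast
          with False show ?thesis
            by (simp add: X_def)
        qed
        with A(3) show False
          by blast
      qed
      then show ?thesis
        by (simp add: w_def)
    qed
    then have "(\<Sum>A | A \<in> assignments n \<and> x \<in> subcube n A. w z A) = (\<Sum>A\<in>{X}. w z A)"
      by (intro sum.mono_neutral_right) (use X in auto)
    then show ?thesis
      by (simp add: wX)
  qed
  show "prt_feasible n \<epsilon> f w"
    unfolding prt_feasible_def using assms by (auto simp: w UNIV_bool) (simp add: w_def)
qed

lemma sum_subcube_eq:
  "(\<Sum>A | A \<in> assignments n \<and> x \<in> subcube n A. w A) =
    (\<Sum>A\<in>assignments n. w A * of_bool (x \<in> subcube n A) :: real)"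
  by (rule sum.mono_neutral_cong_left) auto

lemma covered_le_total:
  assumes "prt_feasible n \<epsilon> f w"
  shows "(\<Sum>A | A \<in> assignments n \<and> x \<in> subcube n A. w z A) \<le>
    (\<Sum>A\<in>assignments n. w z A * 2 ^ card (dom A))"
  unfolding sum_subcube_eq
  by (intro sum_mono mult_left_mono)
    (use assms in \<open>auto simp: prt_feasible_def intro: order_trans[OF _ one_le_power]\<close>)

text \<open>Each of the two values needs weight at least \<open>1 - \<epsilon>\<close> at some
  point. This keeps the partition bound away from 0, so that additive constants can be absorbed into
  multiples of it.\<close>

lemma prt_objective_nonconstant:
  assumes w: "prt_feasible n \<epsilon> f w" and "x \<in> cube n" "y \<in> cube n" "f x \<noteq> f y"
  shows "2 - 2 * \<epsilon> \<le> prt_objective n w"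
proof -
  have "1 - \<epsilon> \<le> (\<Sum>A\<in>assignments n. w (f u) A * 2 ^ card (dom A))" if "u \<in> cube n" for u
    using w that by (intro order_trans[OF _ covered_le_total[OF w, where x = u]]) (simp add: prt_feasible_def)
  from this[OF assms(2)] this[OF assms(3)] assms(4) show ?thesis
    by (cases "f x"; cases "f y") (auto simp: prt_objective_def UNIV_bool)
qed

text \<open>Markov's inequality: a discarded subcube has co-dimension at least \<open>k + 1\<close>,
  so its weight is multiplied by at least \<open>2 ^ (k + 1)\<close> in the objective. The discarded
  weight at any point is therefore at most 1/16.\<close>

lemma short_cover_truncate:
  assumes w: "prt_feasible n \<epsilon> f w" and k: "0 < k" "prt_objective n w \<le> 2 ^ (k + 1) / 16"
    and eps: "0 < \<epsilon>"
  shows "short_cover n k \<epsilon> f w {A \<in> assignments n. card (dom A) \<le> k}"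
proof -
  let ?S = "{A \<in> assignments n. card (dom A) \<le> k}"
  let ?L = "{A \<in> assignments n. \<not> card (dom A) \<le> k}"
  have w0: "0 \<le> w z A" if "A \<in> assignments n" for z A
    using w that by (simp add: prt_feasible_def)
  define cov where "cov T z x = (\<Sum>A\<in>T. w z A * of_bool (x \<in> subcube n A))" for T z x
  have cov_nonneg: "0 \<le> cov T z x" if "T \<subseteq> assignments n" for T z x
    unfolding cov_def using that by (intro sum_nonneg mult_nonneg_nonneg w0) auto
  have split: "cov (assignments n) z x = cov ?S z x + cov ?L z x" for z x
    unfolding cov_def by (subst sum.union_disjoint[symmetric]) (auto intro!: sum.cong)
  have feas: "1 - \<epsilon> \<le> cov (assignments n) (f x) x"
    "cov (assignments n) (f x) x + cov (assignments n) (\<not> f x) x = 1" if "x \<in> cube n" for x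
    using w that by (cases "f x"; auto simp: prt_feasible_def sum_subcube_eq cov_def UNIV_bool)+
  have tail: "cov ?L z x \<le> 1/16" for z x
  proof -
    have "2 ^ (k + 1) * cov ?L z x = (\<Sum>A\<in>?L. w z A * (2 ^ (k + 1) * of_bool (x \<in> subcube n A)))"
      unfolding cov_def sum_distrib_left by (intro sum.cong) auto
    also have "\<dots> \<le> (\<Sum>A\<in>?L. w z A * 2 ^ card (dom A))"
    proof (intro sum_mono mult_left_mono w0)
      fix A assume "A \<in> ?L"
      then have "(2::real) ^ (k + 1) \<le> 2 ^ card (dom A)"
        by (intro power_increasing) auto
      then show "2 ^ (k + 1) * of_bool (x \<in> subcube n A) \<le> (2::real) ^ card (dom A)"
        by (cases "x \<in> subcube n A") auto
    qed auto
    also have "\<dots> \<le> (\<Sum>A\<in>assignments n. w z A * 2 ^ card (dom A))"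
      by (intro sum_mono2) (auto intro!: mult_nonneg_nonneg w0)
    also have "\<dots> \<le> prt_objective n w"
      unfolding prt_objective_def
      by (intro member_le_sum[of z UNIV "\<lambda>z. \<Sum>A\<in>assignments n. w z A * 2 ^ card (dom A)"])
        (auto intro!: sum_nonneg mult_nonneg_nonneg w0)
    also have "\<dots> \<le> 2 ^ (k + 1) * (1/16)"
      using k by simp
    finally show ?thesis
      by (simp only: mult_le_cancel_left_pos zero_less_power zero_less_numeral)
  qed
  show ?thesis
  proof
    fix x assume x: "x \<in> cube n"
    show "1 - \<epsilon> - 1/16 \<le> (\<Sum>A\<in>?S. w (f x) A * of_bool (x \<in> subcube n A))"
      using feas(1)[OF x] tail[of "f x" x] split[of "f x" x] unfolding cov_def by linarith
    \<comment> \<open>The total weight at \<open>x\<close> is 1, of which correct subcubes take at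
      least \<open>1 - \<epsilon>\<close>; truncation only lowers the rest.\<close>
    show "(\<Sum>A\<in>?S. w (\<not> f x) A * of_bool (x \<in> subcube n A)) \<le> \<epsilon>"
      using feas[OF x] cov_nonneg[of ?L "\<not> f x" x] split[of "\<not> f x" x] unfolding cov_def by force
    have "cov ?S (f x) x + cov ?S (\<not> f x) x \<le> 1"
      using feas(2)[OF x] cov_nonneg[of ?L "\<not> f x" x] cov_nonneg[of ?L "f x" x]
        split[of "\<not> f x" x] split[of "f x" x] by force
    then show "(\<Sum>z\<in>UNIV. \<Sum>A\<in>?S. w z A * of_bool (x \<in> subcube n A)) \<le> 1"
      by (cases "f x") (auto simp: cov_def UNIV_bool)
  qed (use k eps w0 in auto)
qed

section \<open>Bounds on the distributional query complexity\<close>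

lemma dist_query_complexity_le:
  assumes \<mu>: "set_pmf \<mu> \<subseteq> cube n" "\<And>x. x \<in> cube n \<Longrightarrow> pmf \<mu> x = weight n p x"
    and T: "query_indices T \<subseteq> {1..n}" "\<And>x. num_queries T x \<le> d" "error n f p T \<le> \<delta>"
  shows "dist_query_complexity n \<mu> \<delta> f \<le> d"
proof -
  have "measure_pmf.prob \<mu> {x \<in> cube n. tree_output T x = f x} =
      (\<Sum>x | x \<in> cube n \<and> tree_output T x = f x. weight n p x)"
    by (subst measure_measure_pmf_finite) (auto simp: \<mu>(2))
  also have "\<dots> = (\<Sum>x\<in>cube n. weight n p x * of_bool (tree_output T x = f x))"
    by (rule sum.mono_neutral_cong_left) auto
  also have "\<dots> = expect n p (\<lambda>x. 1 + (- 1) * of_bool (tree_output T x \<noteq> f x))"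
    unfolding expect_def by (intro sum.cong) auto
  also have "\<dots> = 1 - error n f p T"
    unfolding expect_add expect_cmult expect_const error_def by simp
  finally have "1 - \<delta> \<le> measure_pmf.prob \<mu> {x \<in> cube n. tree_output T x = f x}"
    using T(3) by simp
  then have "dist_query_complexity n \<mu> \<delta> f \<le> worst_case_queries n T"
    unfolding dist_query_complexity_def using T(1) by (intro cInf_lower) auto
  also have "cube n \<noteq> {}"
    by (simp add: cube_def PiE_eq_empty_iff)
  then have "worst_case_queries n T \<le> d"
    unfolding worst_case_queries_def using T(2) by (subst Max_le_iff) auto
  finally show ?thesis .
qed

lemma product_distribution_weight:
  assumes "product_distribution n \<mu>"
  obtains p where "p \<in> biases" "\<And>x. x \<in> cube n \<Longrightarrow> pmf \<mu> x = weight n p x"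
proof -
  obtain m :: "nat \<Rightarrow> bool pmf" where m: "\<And>x. x \<in> cube n \<Longrightarrow> pmf \<mu> x = (\<Prod>i\<in>{1..n}. pmf (m i) (x i))"
    using assms by (auto simp: product_distribution_def)
  have "bern (pmf (m i) True) b = pmf (m i) b" for i b
    by (cases b) (simp_all add: bern_def pmf_False_conv_True)
  then have "pmf \<mu> x = weight n (\<lambda>i. pmf (m i) True) x" if "x \<in> cube n" for x
    using m[OF that] by (simp add: weight_def)
  moreover have "(\<lambda>i. pmf (m i) True) \<in> biases"
    by (simp add: biases_def pmf_le_1)
  ultimately show thesis
    using that by blast
qed

text \<open>There are \<open>t\<close> rounds of at most \<open>k\<close> queries, with
  \<open>t\<close> at most \<open>11 * k * log 2 (1 / \<epsilon>)\<close> and \<open>k\<close> at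
  most 11 times the partition bound; 1331 is 11 cubed.\<close>

lemma query_bound_nonconstant:
  assumes \<epsilon>: "0 < \<epsilon>" "\<epsilon> \<le> 1/8" and \<mu>: "product_distribution n \<mu>"
    and xy: "x \<in> cube n" "y \<in> cube n" "f x \<noteq> f y"
  shows "dist_query_complexity n \<mu> (8 * \<epsilon>) f \<le> 1331 * (prt n \<epsilon> f)\<^sup>2 * log 2 (1 / \<epsilon>)"
proof -
  define V where "V = {prt_objective n w | w. prt_feasible n \<epsilon> f w}"
  \<comment> \<open>7/4 is \<open>2 - 2 * \<epsilon>\<close> at the extreme
    \<open>\<epsilon> = 1/8\<close>.\<close>
  have V: "V \<noteq> {}" "\<And>v. v \<in> V \<Longrightarrow> 7/4 \<le> v"
    using exists_prt_feasible[of \<epsilon> n f] \<epsilon> prt_objective_nonconstant[OF _ xy, of \<epsilon>]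
    by (force simp: V_def)+
  then have Inf: "7/4 \<le> Inf V"
    by (intro cInf_greatest) auto
  define c where "c = prt n \<epsilon> f"
  have c: "2 powr c = Inf V"
    using Inf by (simp add: c_def prt_def V_def)
  have "2 powr (1/2) \<le> 2 powr c"
  proof -
    have "sqrt 2 \<le> (7/4 :: real)"
      by (rule real_le_lsqrt) (auto simp: power2_eq_square)
    then show ?thesis
      unfolding c using Inf by (simp add: powr_half_sqrt)
  qed
  then have c_half: "1/2 \<le> c"
    by simp
  \<comment> \<open>A solution within a factor 2 of the infimum is used, at the price of 1 in the
    exponent.\<close>
  have "Inf V < 2 * Inf V"
    using Inf by simp
  then obtain v where "v \<in> V" "v < 2 * Inf V"
    using cInf_lessD[OF V(1)] by blast
  then obtain w where w: "prt_feasible n \<epsilon> f w" "prt_objective n w < 2 * 2 powr c"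
    unfolding c by (auto simp: V_def)
  \<comment> \<open>The 4 pays for the division by 16 in the truncation. Since
    \<open>c \<ge> 1/2\<close>, \<open>k \<le> c + 5 \<le> 11 * c\<close>.\<close>
  define k where "k = nat \<lceil>c\<rceil> + 4"
  have k: "c + 4 \<le> k" "k \<le> 11 * c" "0 < k"
    unfolding k_def using c_half by linarith+
  have "2 * 2 powr c = 2 powr (c + 5) / 16"
    by (simp add: powr_add)
  also have "\<dots> \<le> 2 powr real (k + 1) / 16"
    using k by (intro divide_right_mono powr_mono) auto
  also have "\<dots> = 2 ^ (k + 1) / 16"
    by (subst powr_realpow) auto
  finally have "prt_objective n w \<le> 2 ^ (k + 1) / 16"
    using w(2) by linarith
  then interpret short_cover n k \<epsilon> f w "{A \<in> assignments n. card (dom A) \<le> k}"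
    using w \<epsilon> k by (intro short_cover_truncate)
  obtain p where p: "p \<in> biases" "\<And>x. x \<in> cube n \<Longrightarrow> pmf \<mu> x = weight n p x"
    using product_distribution_weight[OF \<mu>] by blast
  \<comment> \<open>Chosen so that \<open>exp (- (t / (10 * k)))\<close>, which dominates the decay
    factor, is at most \<open>\<epsilon>\<close>.\<close>
  define t where "t = nat \<lceil>10 * k * ln (1 / \<epsilon>)\<rceil>"
  have ln_pos: "0 < ln (1 / \<epsilon>)"
    using \<epsilon> by (intro ln_gt_zero) auto
  have t: "10 * k * ln (1 / \<epsilon>) \<le> t" "t \<le> 10 * k * ln (1 / \<epsilon>) + 1"
    using ln_pos k(3) mult_pos_pos[of "10 * k" "ln (1 / \<epsilon>)"] unfolding t_def by linarith+
  obtain F where F: "query_indices (F p) \<subseteq> {1..n}" "\<And>x. num_queries (F p) x \<le> k * t"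
    "error n f p (F p) \<le> 6 * \<epsilon> + (1 - 1 / (10 * real k)) ^ t * ((potential p + k) / k)"
    using exists_tree[of t] p(1) by blast
  have "(1 - 1 / (10 * real k)) ^ t \<le> exp (- 1 / (10 * real k)) ^ t"
    using exp_ge_add_one_self[of "- 1 / (10 * real k)"] k(3) by (intro power_mono) (auto simp: field_simps)
  also have "\<dots> = exp (- (t / (10 * k)))"
    by (simp add: exp_of_nat_mult[symmetric])
  also have "\<dots> \<le> exp (- ln (1 / \<epsilon>))"
    using t(1) k(3) by (simp add: pos_le_divide_eq mult.commute mult.left_commute)
  also have "\<dots> = \<epsilon>"
    using \<epsilon> by (simp add: ln_div)
  finally have decay: "(1 - 1 / (10 * real k)) ^ t \<le> \<epsilon>" .
  \<comment> \<open>The decaying term is thus at most \<open>2 * \<epsilon>\<close>, which together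
    with \<open>6 * \<epsilon>\<close> gives the allowed error.\<close>
  have "(potential p + k) / k \<le> 2"
    using potential_le[OF p(1)] k(3) by (simp add: pos_divide_le_eq)
  then have "(1 - 1 / (10 * real k)) ^ t * ((potential p + k) / k) \<le> \<epsilon> * 2"
    using decay \<epsilon> potential_nonneg[OF p(1)] by (intro mult_mono) auto
  then have "error n f p (F p) \<le> 8 * \<epsilon>"
    using F(3) by linarith
  then have "dist_query_complexity n \<mu> (8 * \<epsilon>) f \<le> k * t"
    using \<mu> p(2) F(1,2) by (intro dist_query_complexity_le[where p = p and T = "F p"])
      (auto simp: product_distribution_def)
  then have "real (dist_query_complexity n \<mu> (8 * \<epsilon>) f) \<le> real k * real t"
    by (metis of_nat_le_iff of_nat_mult)
  also have "\<dots> \<le> k * (11 * k * log 2 (1 / \<epsilon>))"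
  proof (intro mult_left_mono)
    have log3: "1 \<le> log 2 (1 / \<epsilon>)"
      using \<epsilon> by (subst le_log_iff) (auto simp: field_simps)
    have "ln 2 \<le> (1::real)"
      using ln_le_minus_one[of 2] by simp
    moreover have "ln (1 / \<epsilon>) = log 2 (1 / \<epsilon>) * ln 2"
      by (simp add: log_def)
    ultimately have "ln (1 / \<epsilon>) \<le> log 2 (1 / \<epsilon>)"
      using log3 by (simp add: mult_left_le)
    then have "10 * k * ln (1 / \<epsilon>) \<le> 10 * k * log 2 (1 / \<epsilon>)"
      by (intro mult_left_mono) auto
    \<comment> \<open>This absorbs the 1 lost by rounding \<open>t\<close> up, turning the factor 10
      into 11.\<close>
    moreover have "1 * 1 \<le> k * log 2 (1 / \<epsilon>)"
      using log3 k(3) by (intro mult_mono) auto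
    ultimately show "real t \<le> 11 * k * log 2 (1 / \<epsilon>)"
      using t(2) by linarith
  qed auto
  also have "\<dots> = 11 * (real k)\<^sup>2 * log 2 (1 / \<epsilon>)"
    by (simp add: power2_eq_square)
  also have "\<dots> \<le> 11 * (11 * c)\<^sup>2 * log 2 (1 / \<epsilon>)"
    using k \<epsilon> by (intro mult_right_mono mult_left_mono power_mono) (auto simp: field_simps)
  finally show ?thesis
    by (simp add: c_def power_mult_distrib)
qed

text \<open>Constant functions are treated apart: their partition bound is 0, by placing all weight
  on the empty assignment, so the complexity has to be exactly 0.\<close>

lemma query_bound_constant:
  assumes \<mu>: "product_distribution n \<mu>" and const: "\<And>x. x \<in> cube n \<Longrightarrow> f x = z" and "0 \<le> \<delta>"
  shows "dist_query_complexity n \<mu> \<delta> f = 0"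
proof -
  obtain p where p: "p \<in> biases" "\<And>x. x \<in> cube n \<Longrightarrow> pmf \<mu> x = weight n p x"
    using product_distribution_weight[OF \<mu>] by blast
  have "error n f p (Output z) = expect n p (\<lambda>_. 0)"
    unfolding error_def by (rule expect_cong) (simp add: const)
  then have "dist_query_complexity n \<mu> \<delta> f \<le> 0"
    using \<mu> p(2) assms(3) by (intro dist_query_complexity_le[where p = p and T = "Output z"])
      (auto simp: product_distribution_def expect_const)
  then show ?thesis
    by simp
qed

theorem theorem3:
  "\<exists>K::real. K > 0 \<and>
     (\<forall>(n::nat) (f :: (nat \<Rightarrow> bool) \<Rightarrow> bool) (\<epsilon>::real) (\<mu> :: (nat \<Rightarrow> bool) pmf).
        n \<ge> 1 \<longrightarrow> 0 \<le> \<epsilon> \<longrightarrow> \<epsilon> \<le> 1 / 8 \<longrightarrow> product_distribution n \<mu> \<longrightarrow>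
        ereal (real (dist_query_complexity n \<mu> (8 * \<epsilon>) f))
          \<le> (if \<epsilon> = 0 then \<infinity> else ereal (K * (prt n \<epsilon> f)\<^sup>2 * log 2 (1 / \<epsilon>))))"
proof (intro exI[of _ "1331 :: real"] conjI allI impI)
  fix n f and \<epsilon> :: real and \<mu> :: "(nat \<Rightarrow> bool) pmf"
  assume *: "0 \<le> \<epsilon>" "\<epsilon> \<le> 1/8" "product_distribution n \<mu>"
  have "real (dist_query_complexity n \<mu> (8 * \<epsilon>) f) \<le> 1331 * (prt n \<epsilon> f)\<^sup>2 * log 2 (1 / \<epsilon>)"
    if "\<epsilon> \<noteq> 0"
  proof (cases "\<exists>x\<in>cube n. \<exists>y\<in>cube n. f x \<noteq> f y")
    case True
    with * that show ?thesis
      using query_bound_nonconstant[of \<epsilon> n \<mu>] by force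
  next
    case False
    then obtain z where "\<And>x. x \<in> cube n \<Longrightarrow> f x = z"
      by blast
    then have "dist_query_complexity n \<mu> (8 * \<epsilon>) f = 0"
      using * by (intro query_bound_constant) auto
    moreover have "0 \<le> log 2 (1 / \<epsilon>)"
      using * that by simp
    ultimately show ?thesis
      by simp
  qed
  then show "ereal (real (dist_query_complexity n \<mu> (8 * \<epsilon>) f))
      \<le> (if \<epsilon> = 0 then \<infinity> else ereal (1331 * (prt n \<epsilon> f)\<^sup>2 * log 2 (1 / \<epsilon>)))"
    by simp
qed simp

end
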